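(* Consider iterates $x^k=[(x_1^k)^T,\dots,(x_m^k)^T]^T\in\mathbb{R}^{md}$ generated by algorithm PDG-DS, $$x^{k+1}=(W\otimes I_d)x^k-\left((B^k\Lambda^k)\otimes I_d\right)g^k,\qquad k=0,1,2,\dots$$ Suppose that $W=\{w_{ij}\}\in\mathbb{R}^{m\times m}$ satisfies $\mathbf{1}^TW=\mathbf{1}^T$, $W\mathbf{1}=\mathbf{1}$ and $\eta=\|W-\frac{\mathbf{1}\mathbf{1}^T}{m}\|<1$. Suppose that the problem $\min_{\theta\in\mathbb{R}^d}F(\theta)$, $F=\frac1m\sum_{i=1}^m f_i$, has at least one optimal solution, and that every $f_i:\mathbb{R}^d\to\mathbb{R}$ is convex and has Lipschitz continuous gradient, i.e., for some $L>0$, $\|\nabla f_i(u)-\nabla f_i(v)\|\le L\|u-v\|$ for all $i$ and all $u,v\in\mathbb{R}^d$. If the stepsizes of every agent $i$ are nonnegative and satisfy $\sum_{k=0}^\infty\lambda_i^k=+\infty$ and $\sum_{k=0}^\infty(\lambda_i^k)^2<\infty$, and the stepsize heterogeneity satisfies $$\sum_{k=0}^\infty\ \sum_{i,j\in\{1,\dots,m\},\,i\ne j}|\lambda_i^k-\lambda_j^k|<\infty,$$ then $\lim_{k\to\infty}\|x_i^k-\bar x^k\|=0$ for all $i$, and there exists an optimal solution $\tilde\theta^*$ of the problem such that $\lim_{k\to\infty}\|\bar x^k-\tilde\theta^*\|=0$.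
   Context: There are $m$ agents on an undirected graph described by the nonnegative weight matrix $W$: $w_{ij}>0$ if agents $i$ and $j$ can interact, $w_{ij}=0$ otherwise, and $w_{ii}>0$ for all $i$. The neighbor set is $\mathbb{N}_i=\{j: w_{ij}>0\}$ (it contains $i$). In PDG-DS, $g^k=[(g_1^k)^T,\dots,(g_m^k)^T]^T$ with $g_i^k=\nabla f_i(x_i^k)$; $\Lambda^k=\mathrm{diag}[\lambda_1^k,\dots,\lambda_m^k]$, where $\lambda_i^k\ge0$ is the stepsize of agent $i$ at iteration $k$; and $B^k=\{b_{ij}^k\}\in\mathbb{R}^{m\times m}$ is a (possibly time-varying) column-stochastic matrix (nonnegative entries, each column sums to one) with $b_{ij}^k>0$ for $i\in\mathbb{N}_j$ and $b_{ij}^k=0$ for $i\notin\mathbb{N}_j$. The initial $x^0$ is arbitrary. $\bar x^k=\frac1m\sum_{i=1}^m x_i^k$, $\mathbf{1}$ is the all-ones vector, $\otimes$ is the Kronecker product, and $\|\cdot\|$ is the Euclidean norm for vectors and the spectral norm for matrices. *)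

theory Defs
  imports "HOL-Analysis.Analysis"
begin

definition diag_matrix :: "real ^ 'n \<Rightarrow> real ^ 'n ^ 'n" where
  "diag_matrix v = (\<chi> i j. if i = j then v $ i else 0)"

text \<open>The index set of the stacked vectors in \<open>\<real>\<^sup>m\<^sup>d\<close> is \<open>'m \<times> 'd\<close>: entry \<open>(i, c)\<close> is
  coordinate \<open>c\<close> of the block of agent \<open>i\<close>. The Kronecker product pairs row and column indices
  in the same order.\<close>

definition kronecker ::
  "real ^ 'n ^ 'm \<Rightarrow> real ^ 'q ^ 'p \<Rightarrow> real ^ ('n::finite \<times> 'q::finite) ^ ('m::finite \<times> 'p::finite)" (infixl "\<otimes>\<^sub>K" 70) where
  "A \<otimes>\<^sub>K C = (\<chi> r s. A $ fst r $ fst s * C $ snd r $ snd s)"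

definition stack :: "('m::finite \<Rightarrow> real ^ 'd) \<Rightarrow> real ^ ('m \<times> 'd::finite)" where
  "stack v = (\<chi> p. v (fst p) $ snd p)"

definition block :: "real ^ ('m::finite \<times> 'd::finite) \<Rightarrow> 'm \<Rightarrow> real ^ 'd" where
  "block x i = (\<chi> c. x $ (i, c))"

definition block_mean :: "real ^ ('m::finite \<times> 'd::finite) \<Rightarrow> real ^ 'd" where
  "block_mean x = (1 / real CARD('m)) *\<^sub>R (\<Sum>i\<in>UNIV. block x i)"

text \<open>Undirectedness of the interaction graph constrains only the positivity pattern of the
  weight matrix; \<open>W\<close> itself need not be symmetric.\<close>

definition interaction_weights :: "real ^ 'm ^ 'm \<Rightarrow> bool" where
  "interaction_weights W \<longleftrightarrow>
     (\<forall>i j. 0 \<le> W $ i $ j) \<and> (\<forall>i. 0 < W $ i $ i) \<and>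
     (\<forall>i j. 0 < W $ i $ j \<longleftrightarrow> 0 < W $ j $ i)"

definition neighbors :: "real ^ 'm ^ 'm \<Rightarrow> 'm \<Rightarrow> 'm set" where
  "neighbors W i = {j. 0 < W $ i $ j}"

definition column_stochastic :: "real ^ 'n ^ 'm \<Rightarrow> bool" where
  "column_stochastic B \<longleftrightarrow> (\<forall>i j. 0 \<le> B $ i $ j) \<and> (\<forall>j. (\<Sum>i\<in>UNIV. B $ i $ j) = 1)"

definition mixing_matrix :: "real ^ 'm ^ 'm \<Rightarrow> real ^ 'm ^ 'm \<Rightarrow> bool" where
  "mixing_matrix W B \<longleftrightarrow> column_stochastic B \<and>
     (\<forall>i j. (i \<in> neighbors W j \<longrightarrow> 0 < B $ i $ j) \<and> (i \<notin> neighbors W j \<longrightarrow> B $ i $ j = 0))"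

text \<open>The operator norm induced by the Euclidean norm.\<close>

definition spectral_norm :: "real ^ 'n ^ 'm \<Rightarrow> real" where
  "spectral_norm A = onorm ((*v) A)"

text \<open>In the recursion, \<open>G i\<close> is the gradient of the objective of agent \<open>i\<close>.\<close>

definition pdg_ds ::
  "real ^ 'm ^ 'm \<Rightarrow> (nat \<Rightarrow> real ^ 'm ^ 'm) \<Rightarrow> (nat \<Rightarrow> real ^ 'm) \<Rightarrow>
   ('m \<Rightarrow> real ^ 'd \<Rightarrow> real ^ 'd) \<Rightarrow> (nat \<Rightarrow> real ^ ('m::finite \<times> 'd::finite)) \<Rightarrow> bool" where
  "pdg_ds W B lam G x \<longleftrightarrow>
     (\<forall>k. x (Suc k) = (W \<otimes>\<^sub>K (mat 1 :: real ^ 'd ^ 'd)) *v x k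
        - ((B k ** diag_matrix (lam k)) \<otimes>\<^sub>K (mat 1 :: real ^ 'd ^ 'd))
            *v stack (\<lambda>i. G i (block (x k) i)))"

definition average_objective :: "('m::finite \<Rightarrow> real ^ 'd \<Rightarrow> real) \<Rightarrow> real ^ 'd \<Rightarrow> real" where
  "average_objective f \<theta> = (1 / real CARD('m)) * (\<Sum>i\<in>UNIV. f i \<theta>)"

end

theory Submission
  imports Defs
begin

text \<open>
  Fix a minimizer \<open>\<theta>\<close> and follow the energy
  \<open>V = \<parallel>z - \<theta>\<parallel>\<^sup>2 + D\<close>, where \<open>z\<close> is the mean of the agents and
  \<open>D = \<Sum>\<^sub>i \<parallel>x\<^sub>i - z\<parallel>\<^sup>2\<close> is their dispersion. The two parts help each other.

  Mixing by \<open>W\<close> keeps \<open>z\<close> and shrinks \<open>D\<close> by the factor \<open>\<eta>\<^sup>2 < 1\<close>, while the gradient steps, at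
  the price of a slightly larger factor, add only terms of second order in the stepsizes
  (\<open>dispersion_step\<close>). The columns of \<open>W\<close> and
  \<open>B\<close> sum to one, so \<open>z\<close> moves exactly by the average of \<open>\<lambda>\<^sub>j \<nabla>f\<^sub>j(x\<^sub>j)\<close>. If all stepsizes were
  equal to \<open>\<mu>\<close> and all agents sat at \<open>z\<close>, this would be a gradient step for \<open>F\<close>, which lowers
  \<open>\<parallel>z - \<theta>\<parallel>\<^sup>2\<close> by at least \<open>2 \<mu> (F z - F \<theta>)\<close> up to \<open>O(\<mu>\<^sup>2)\<close>. Unequal stepsizes cost a multiple
  of their spread, which is summable. Disagreement of the agents costs
  \<open>\<mu> \<surd>D \<parallel>z - \<theta>\<parallel>\<close>, which is first order in the stepsize; by Young's inequality it is at most
  \<open>\<epsilon> D + \<mu>\<^sup>2 \<parallel>z - \<theta>\<parallel>\<^sup>2 / \<epsilon>\<close> up to constants (\<open>mean_descent\<close>), and the contraction of \<open>D\<close>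
  absorbs \<open>\<epsilon> D\<close>. The gradients may be unbounded, but by the Lipschitz condition their squares
  grow at most like \<open>V + 1\<close>. Altogether (\<open>lyapunov_decrease\<close>)
  \<open>V\<^sub>k\<^sub>+\<^sub>1 \<le> V\<^sub>k + t\<^sub>k (V\<^sub>k + 1) - (2 \<mu>\<^sub>k (F z\<^sub>k - F \<theta>) + \<gamma> D\<^sub>k)\<close> with \<open>\<Sum> t\<^sub>k < \<infinity>\<close> and \<open>\<gamma> > 0\<close>.

  The deterministic Robbins--Siegmund lemma then says that \<open>V\<^sub>k\<close> converges and that
  \<open>\<Sum> D\<^sub>k\<close> and \<open>\<Sum> \<mu>\<^sub>k (F z\<^sub>k - F \<theta>)\<close> are finite. Hence \<open>D\<^sub>k\<close> tends to zero, which is consensus, and the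
  distance of \<open>z\<^sub>k\<close> to every minimizer converges. As \<open>\<Sum> \<mu>\<^sub>k\<close> diverges, \<open>F z\<^sub>k\<close> comes arbitrarily
  close to the minimum, so some minimizer is a cluster point of \<open>z\<^sub>k\<close>; the distance to it
  converges, necessarily to zero (\<open>converges_to_minimizer\<close>).
\<close>

section \<open>Convergence principles\<close>

text \<open>The factors \<open>1 + t k\<close> have a bounded product because \<open>t\<close> is summable, so
  \<open>V + 1\<close> is bounded by some \<open>M\<close>. This turns the recursion into a plain descent with
  total error at most \<open>M * suminf t\<close>, and telescoping bounds the sum of the \<open>w k\<close>.\<close>

lemma deterministic_robbins_siegmund:
  fixes V t w :: "nat \<Rightarrow> real"
  assumes V: "\<And>k. 0 \<le> V k" and t: "\<And>k. 0 \<le> t k" and w: "\<And>k. 0 \<le> w k"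
    and sum_t: "summable t"
    and step: "\<And>k. V (Suc k) \<le> V k + t k * (V k + 1) - w k"
  shows "convergent V" and "summable w"
proof -
  define T where "T n = (\<Sum>k<n. t k)" for n
  have T_le: "T n \<le> suminf t" for n
    unfolding T_def by (rule sum_le_suminf[OF sum_t]) (auto simp: t)
  have bound: "V n + 1 \<le> (V 0 + 1) * exp (T n)" for n
  proof (induction n)
    case 0
    show ?case by (simp add: T_def)
  next
    case (Suc n)
    have "V (Suc n) + 1 \<le> (V n + 1) * (1 + t n)"
      using step[of n] w[of n] by (simp add: algebra_simps)
    also have "\<dots> \<le> (V n + 1) * exp (t n)"
      using V[of n] by (intro mult_left_mono) (auto simp: exp_ge_add_one_self)
    also have "\<dots> \<le> (V 0 + 1) * exp (T n) * exp (t n)"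
      using Suc by (intro mult_right_mono) auto
    finally show ?case by (simp add: T_def exp_add mult_ac)
  qed
  define M where "M = (V 0 + 1) * exp (suminf t)"
  have M: "V n + 1 \<le> M" for n
  proof -
    have "(V 0 + 1) * exp (T n) \<le> M"
      unfolding M_def using V[of 0] T_le[of n] by (intro mult_left_mono) auto
    with bound[of n] show ?thesis by linarith
  qed
  have M0: "0 \<le> M" using M[of 0] V[of 0] by linarith
  have drift: "V (Suc k) \<le> V k + t k * M - w k" for k
    using step[of k] mult_left_mono[OF M[of k] t[of k]] by linarith
  \<comment> \<open>Subtracting the errors accumulated so far makes the sequence decreasing.\<close>
  define Y where "Y n = V n - M * T n" for n
  have "decseq Y"
    unfolding decseq_Suc_iff
  proof
    fix n
    show "Y (Suc n) \<le> Y n"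
      using drift[of n] w[of n] by (simp add: Y_def T_def algebra_simps)
  qed
  moreover have "- (M * suminf t) \<le> Y n" for n
    using V[of n] mult_left_mono[OF T_le[of n] M0] by (simp add: Y_def)
  ultimately obtain l where "Y \<longlonglongrightarrow> l"
    using decseq_convergent[of Y "- (M * suminf t)"] by blast
  moreover have "T \<longlonglongrightarrow> suminf t"
    unfolding T_def using summable_LIMSEQ[OF sum_t] .
  ultimately have "(\<lambda>n. Y n + M * T n) \<longlonglongrightarrow> l + M * suminf t"
    by (intro tendsto_intros)
  then show "convergent V" by (auto simp: Y_def convergent_def)
  show "summable w"
  proof (rule summableI_nonneg_bounded[OF w])
    fix n
    have "(\<Sum>k<n. w k) \<le> V 0 - V n + M * T n"
    proof (induction n)
      case (Suc n)
      then show ?case using drift[of n] by (simp add: T_def algebra_simps)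
    qed (simp add: T_def)
    also have "\<dots> \<le> V 0 + M * suminf t"
      using V[of n] mult_left_mono[OF T_le[of n] M0] by linarith
    finally show "(\<Sum>k<n. w k) \<le> V 0 + M * suminf t" .
  qed
qed

text \<open>Restricting to the line through \<open>x\<close> and \<open>y\<close> reduces this to the tangent inequality for
  convex functions of one real variable.\<close>

lemma convex_gradient_inequality:
  fixes f :: "'a::euclidean_space \<Rightarrow> real"
  assumes "convex_on UNIV f" and "GDERIV f x :> g"
  shows "f x + g \<bullet> (y - x) \<le> f y"
proof -
  define \<phi> where "\<phi> s = f (x + s *\<^sub>R (y - x))" for s :: real
  have "convex_on UNIV \<phi>"
  proof (rule convex_onI)
    fix t a b :: real assume "0 < t" "t < 1"
    have "x + ((1 - t) *\<^sub>R a + t *\<^sub>R b) *\<^sub>R (y - x)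
        = (1 - t) *\<^sub>R (x + a *\<^sub>R (y - x)) + t *\<^sub>R (x + b *\<^sub>R (y - x))"
      by (simp add: algebra_simps)
    then show "\<phi> ((1 - t) *\<^sub>R a + t *\<^sub>R b) \<le> (1 - t) * \<phi> a + t * \<phi> b"
      using convex_onD[OF assms(1), of t "x + a *\<^sub>R (y - x)" "x + b *\<^sub>R (y - x)"]
        \<open>0 < t\<close> \<open>t < 1\<close> by (simp add: \<phi>_def)
  qed simp
  moreover have "(\<phi> has_real_derivative g \<bullet> (y - x)) (at 0)"
  proof -
    have "((\<lambda>s::real. x + s *\<^sub>R (y - x)) has_derivative (\<lambda>s. s *\<^sub>R (y - x))) (at 0)"
      by (auto intro!: derivative_eq_intros)
    moreover have "(f has_derivative (\<lambda>h. h \<bullet> g)) (at (x + (0::real) *\<^sub>R (y - x)))"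
      using assms(2) by (simp add: gderiv_def)
    ultimately have "((\<lambda>s. f (x + s *\<^sub>R (y - x))) has_derivative (\<lambda>s. (s *\<^sub>R (y - x)) \<bullet> g)) (at 0)"
      by (rule has_derivative_compose)
    then show ?thesis
      by (simp add: \<phi>_def[abs_def] has_field_derivative_def inner_commute mult_commute_abs)
  qed
  ultimately have "\<phi> 1 - \<phi> 0 \<ge> g \<bullet> (y - x) * (1 - 0)"
    using convex_on_imp_above_tangent[of UNIV \<phi> 0 1] by auto
  then show ?thesis by (simp add: \<phi>_def)
qed

text \<open>An Opial-type argument. Divergence of the weights forces \<open>F (z k)\<close> to come close to the
  minimum infinitely often, so boundedness gives a subsequence with a limit that is a minimizer.
  The distances to that limit converge along the whole sequence, hence have the same limit as along
  the subsequence. Note that \<open>dist\<close> is needed for all minimizers since the limit is not known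
  beforehand.\<close>

lemma converges_to_minimizer:
  fixes z :: "nat \<Rightarrow> 'a::euclidean_space" and F :: "'a \<Rightarrow> real" and \<mu> :: "nat \<Rightarrow> real"
  assumes cont: "continuous_on UNIV F"
    and min: "is_arg_min F (\<lambda>_. True) \<theta>"
    and dist: "\<And>\<theta>. is_arg_min F (\<lambda>_. True) \<theta> \<Longrightarrow> convergent (\<lambda>k. norm (z k - \<theta>))"
    and \<mu>: "\<And>k. 0 \<le> \<mu> k" and div: "\<not> summable \<mu>"
    and gap: "summable (\<lambda>k. \<mu> k * (F (z k) - F \<theta>))"
  shows "\<exists>\<theta>. is_arg_min F (\<lambda>_. True) \<theta> \<and> (\<lambda>k. norm (z k - \<theta>)) \<longlonglongrightarrow> 0"
proof -
  have F_ge: "F \<theta> \<le> F y" for y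
    using min by (simp add: is_arg_min_linorder)
  \<comment> \<open>Otherwise the summable sequence \<open>\<mu> k * (F (z k) - F \<theta>)\<close> would eventually dominate \<open>\<epsilon> * \<mu> k\<close>.\<close>
  have "\<exists>k\<ge>n. F (z k) - F \<theta> < \<epsilon>" if "\<epsilon> > 0" for \<epsilon> n
  proof (rule ccontr)
    assume "\<not> ?thesis"
    then have far: "\<epsilon> \<le> F (z k) - F \<theta>" if "k \<ge> n" for k using that by force
    have "summable \<mu>"
    proof (rule summable_comparison_test')
      show "summable (\<lambda>k. (1 / \<epsilon>) * (\<mu> k * (F (z k) - F \<theta>)))"
        using gap by (rule summable_mult)
      fix k assume "n \<le> k"
      then have "\<mu> k * \<epsilon> \<le> \<mu> k * (F (z k) - F \<theta>)"
        using far \<mu> by (intro mult_left_mono) auto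
      then show "norm (\<mu> k) \<le> (1 / \<epsilon>) * (\<mu> k * (F (z k) - F \<theta>))"
        using \<open>\<epsilon> > 0\<close> \<mu>[of k] by (simp add: field_simps)
    qed
    with div show False ..
  qed
  then have "\<forall>n. \<exists>k\<ge>n. F (z k) - F \<theta> < 1 / real (Suc n)" by simp
  then obtain h where h: "\<And>n. n \<le> h n" "\<And>n. F (z (h n)) - F \<theta> < 1 / real (Suc n)"
    by metis
  have "Bseq (\<lambda>k. norm (z k - \<theta>))"
    using dist[OF min] by (rule convergent_imp_Bseq)
  then obtain K where K: "norm (z k - \<theta>) \<le> K" for k
    by (auto simp: Bseq_def)
  have in_ball: "\<forall>n. z (h n) \<in> cball \<theta> K"
    using K by (simp add: dist_norm norm_minus_commute)
  obtain \<theta>' r where r: "strict_mono r" and lim: "(z \<circ> h \<circ> r) \<longlonglongrightarrow> \<theta>'"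
    using compact_cball[of \<theta> K] in_ball unfolding compact_eq_seq_compact_metric seq_compact_def
    by (metis comp_apply)
  have "(\<lambda>n. F ((z \<circ> h \<circ> r) n)) \<longlonglongrightarrow> F \<theta>'"
    by (rule continuous_on_tendsto_compose[OF cont lim]) auto
  moreover have "(\<lambda>n. F ((z \<circ> h \<circ> r) n)) \<longlonglongrightarrow> F \<theta>"
  proof (rule tendsto_sandwich[where f = "\<lambda>_. F \<theta>" and h = "\<lambda>n. F \<theta> + 1 / real (Suc (r n))"])
    have "(\<lambda>n. 1 / real (Suc n)) \<longlonglongrightarrow> 0"
      using LIMSEQ_inverse_real_of_nat by (simp add: inverse_eq_divide)
    from LIMSEQ_subseq_LIMSEQ[OF this r]
    show "(\<lambda>n. F \<theta> + 1 / real (Suc (r n))) \<longlonglongrightarrow> F \<theta>"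
      by (auto simp: o_def intro: tendsto_eq_intros)
    show "\<forall>\<^sub>F n in sequentially. F ((z \<circ> h \<circ> r) n) \<le> F \<theta> + 1 / real (Suc (r n))"
      using h(2) by (intro always_eventually allI) (simp add: diff_less_eq less_imp_le add.commute)
  qed (auto simp: F_ge)
  ultimately have "F \<theta>' = F \<theta>" by (rule LIMSEQ_unique)
  then have min': "is_arg_min F (\<lambda>_. True) \<theta>'"
    using F_ge by (simp add: is_arg_min_linorder)
  then obtain l where l: "(\<lambda>k. norm (z k - \<theta>')) \<longlonglongrightarrow> l"
    using dist by (auto simp: convergent_def)
  have "filterlim (h \<circ> r) sequentially sequentially"
  proof (rule filterlim_at_top_mono[OF filterlim_ident])
    show "\<forall>\<^sub>F n in sequentially. n \<le> (h \<circ> r) n"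
      using order_trans[OF seq_suble[OF r] h(1)] by (simp add: always_eventually)
  qed
  from filterlim_compose[OF l this]
  have "(\<lambda>n. norm ((z \<circ> h \<circ> r) n - \<theta>')) \<longlonglongrightarrow> l" by simp
  moreover have "(\<lambda>n. norm ((z \<circ> h \<circ> r) n - \<theta>')) \<longlonglongrightarrow> 0"
    using tendsto_norm_zero[OF LIM_zero[OF lim]] .
  ultimately have "l = 0" by (rule LIMSEQ_unique)
  with l min' show ?thesis by blast
qed

section \<open>Mean and dispersion of the agents\<close>

definition agent_mean :: "('m::finite \<Rightarrow> 'a::real_vector) \<Rightarrow> 'a" where
  "agent_mean u = (1 / real CARD('m)) *\<^sub>R (\<Sum>i\<in>UNIV. u i)"

definition dispersion :: "('m::finite \<Rightarrow> 'a::real_normed_vector) \<Rightarrow> real" where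
  "dispersion u = (\<Sum>i\<in>UNIV. (norm (u i - agent_mean u))\<^sup>2)"

lemma dispersion_nonneg: "0 \<le> dispersion u"
  by (simp add: dispersion_def sum_nonneg)

lemma deviation_le_dispersion: "(norm (u i - agent_mean u))\<^sup>2 \<le> dispersion u"
  unfolding dispersion_def by (rule member_le_sum) auto

lemma sum_eq_agent_mean:
  "(\<Sum>i\<in>UNIV. u i) = real CARD('m) *\<^sub>R agent_mean (u :: 'm::finite \<Rightarrow> 'a::real_vector)"
  by (simp add: agent_mean_def)

lemma agent_mean_diff: "agent_mean (\<lambda>i. u i - v i) = agent_mean u - agent_mean v"
  by (simp add: agent_mean_def sum_subtractf scaleR_right_diff_distrib)

lemma norm_agent_mean_le:
  assumes "\<And>i. norm (u i) \<le> c"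
  shows "norm (agent_mean (u :: 'm::finite \<Rightarrow> 'a::real_normed_vector)) \<le> c"
proof -
  have "norm (\<Sum>i\<in>UNIV. u i) \<le> real CARD('m) * c"
    using sum_norm_bound[of UNIV u c] assms by simp
  then show ?thesis
    by (simp add: agent_mean_def field_simps)
qed

text \<open>A matrix whose columns sum to one redistributes the vectors among the agents but preserves
  their total.\<close>

lemma agent_mean_average:
  assumes "\<And>j. (\<Sum>i\<in>UNIV. (A :: real ^ 'm ^ 'm) $ i $ j) = 1"
  shows "agent_mean (\<lambda>i. \<Sum>j\<in>UNIV. A $ i $ j *\<^sub>R u j) = agent_mean (u :: 'm::finite \<Rightarrow> 'a::real_vector)"
proof -
  have "(\<Sum>i\<in>UNIV. \<Sum>j\<in>UNIV. A $ i $ j *\<^sub>R u j) = (\<Sum>j\<in>UNIV. (\<Sum>i\<in>UNIV. A $ i $ j) *\<^sub>R u j)"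
    by (subst sum.swap) (simp add: scaleR_left.sum)
  then show ?thesis by (simp add: agent_mean_def assms)
qed

lemma sum_norm_sq_Basis:
  "(norm (v :: 'a::euclidean_space))\<^sup>2 = (\<Sum>b\<in>Basis. (v \<bullet> b)\<^sup>2)"
  unfolding power2_norm_eq_inner euclidean_inner[of v v] by (simp add: power2_eq_square)

text \<open>The norm bound for \<open>A\<close> on \<open>\<real>\<^sup>n\<close> carries over to families of vectors, because \<open>A\<close> acts on each
  coordinate separately and squared norms add up over coordinates. In matrix
  terms, \<open>\<parallel>A \<otimes> I\<parallel> \<le> \<parallel>A\<parallel>\<close>.\<close>

lemma spectral_norm_blockwise:
  fixes A :: "real ^ 'n ^ 'm" and u :: "'n::finite \<Rightarrow> 'a::euclidean_space"
  shows "(\<Sum>i\<in>UNIV. (norm (\<Sum>j\<in>UNIV. A $ i $ j *\<^sub>R u j))\<^sup>2)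
           \<le> (spectral_norm A)\<^sup>2 * (\<Sum>j\<in>UNIV. (norm (u j))\<^sup>2)"
proof -
  \<comment> \<open>The vector of the \<open>b\<close>-coordinates of all agents.\<close>
  define w where "w b = (\<chi> j. u j \<bullet> b)" for b
  have norm_vec: "(norm z)\<^sup>2 = (\<Sum>i\<in>UNIV. (z $ i)\<^sup>2)" for z :: "real ^ 'k"
    unfolding power2_norm_eq_inner inner_vec_def by (simp add: power2_eq_square)
  have "(\<Sum>i\<in>UNIV. (norm (\<Sum>j\<in>UNIV. A $ i $ j *\<^sub>R u j))\<^sup>2)
      = (\<Sum>i\<in>UNIV. \<Sum>b\<in>Basis. ((A *v w b) $ i)\<^sup>2)"
    by (simp add: sum_norm_sq_Basis inner_sum_left matrix_vector_mult_def w_def)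
  also have "\<dots> = (\<Sum>b\<in>Basis. (norm (A *v w b))\<^sup>2)"
    by (subst sum.swap) (simp add: norm_vec)
  also have "\<dots> \<le> (\<Sum>b\<in>(Basis::'a set). (spectral_norm A * norm (w b))\<^sup>2)"
    unfolding spectral_norm_def
    by (intro sum_mono power_mono onorm matrix_vector_mul_bounded_linear) auto
  also have "\<dots> = (spectral_norm A)\<^sup>2 * (\<Sum>b\<in>(Basis::'a set). (norm (w b))\<^sup>2)"
    by (simp add: power_mult_distrib sum_distrib_left)
  also have "(\<Sum>b\<in>(Basis::'a set). (norm (w b))\<^sup>2) = (\<Sum>j\<in>UNIV. \<Sum>b\<in>Basis. (u j \<bullet> b)\<^sup>2)"
    by (subst sum.swap) (simp add: norm_vec w_def)
  also have "\<dots> = (\<Sum>j\<in>UNIV. (norm (u j))\<^sup>2)"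
    by (simp add: sum_norm_sq_Basis)
  finally show ?thesis .
qed

text \<open>The averaging matrix \<open>J\<close>, with entries \<open>1 / m\<close>, annihilates deviations from the
  mean, and \<open>W\<close> fixes constant families, so \<open>W - J\<close> maps the deviations to the deviations of the mixed family from the old mean.\<close>

lemma mixing_contracts_dispersion:
  fixes W :: "real ^ 'm ^ 'm" and u :: "'m::finite \<Rightarrow> 'a::euclidean_space"
  assumes rows: "\<And>i. (\<Sum>j\<in>UNIV. W $ i $ j) = 1"
  shows "(\<Sum>i\<in>UNIV. (norm ((\<Sum>j\<in>UNIV. W $ i $ j *\<^sub>R u j) - agent_mean u))\<^sup>2)
           \<le> (spectral_norm (W - (\<chi> i j. 1 / real CARD('m))))\<^sup>2 * dispersion u"
proof -
  have "(\<Sum>j\<in>UNIV. (W - (\<chi> i j. 1 / real CARD('m))) $ i $ j *\<^sub>R (u j - agent_mean u))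
      = (\<Sum>j\<in>UNIV. W $ i $ j *\<^sub>R u j) - agent_mean u" (is "?l = ?r") for i
  proof -
    have "?l = (\<Sum>j\<in>UNIV. W $ i $ j *\<^sub>R u j) - (\<Sum>j\<in>UNIV. W $ i $ j) *\<^sub>R agent_mean u
        - (1 / real CARD('m)) *\<^sub>R ((\<Sum>j\<in>UNIV. u j) - real CARD('m) *\<^sub>R agent_mean u)"
      by (simp add: scaleR_left_diff_distrib scaleR_right_diff_distrib sum_subtractf
          scaleR_left.sum scaleR_right.sum sum_constant_scaleR del: sum_constant)
    then show ?thesis by (simp only: rows sum_eq_agent_mean[of u]) simp
  qed
  then show ?thesis
    using spectral_norm_blockwise[of "W - (\<chi> i j. 1 / real CARD('m))" "\<lambda>j. u j - agent_mean u"]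
    by (simp add: dispersion_def)
qed

text \<open>Expanding \<open>\<parallel>s a + b\<parallel>\<^sup>2 \<ge> 0\<close> and dividing by \<open>s\<close> bounds the cross term. A small \<open>s\<close> keeps the factor
  of \<open>a\<close> close to one, which is what preserves the contraction below.\<close>

lemma norm_diff_squared_le:
  fixes a b :: "'a::real_inner"
  assumes "s > 0"
  shows "(norm (a - b))\<^sup>2 \<le> (1 + s) * (norm a)\<^sup>2 + (1 + 1 / s) * (norm b)\<^sup>2"
proof -
  have "(norm (a - b))\<^sup>2 = (norm a)\<^sup>2 + (norm b)\<^sup>2 - 2 * (a \<bullet> b)"
    by (simp add: power2_norm_eq_inner inner_diff_left inner_diff_right inner_commute)
  moreover have "0 \<le> (norm (s *\<^sub>R a + b))\<^sup>2 / s"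
    using assms by simp
  moreover have sq: "(norm (s *\<^sub>R a + b))\<^sup>2 = s\<^sup>2 * (norm a)\<^sup>2 + 2 * s * (a \<bullet> b) + (norm b)\<^sup>2"
    unfolding power2_norm_eq_inner
    by (simp add: inner_add_left inner_add_right inner_commute power2_eq_square algebra_simps)
  moreover have "(norm (s *\<^sub>R a + b))\<^sup>2 / s = s * (norm a)\<^sup>2 + 2 * (a \<bullet> b) + (norm b)\<^sup>2 / s"
    unfolding sq using assms by (simp add: field_simps power2_eq_square)
  ultimately show ?thesis by (simp add: algebra_simps)
qed

text \<open>Mixing contracts the deviations; the perturbations \<open>p\<close> deviate from their own mean by at most
  \<open>2 * c\<close>, which explains the constant \<open>4\<close>.\<close>

lemma dispersion_step:
  fixes W :: "real ^ 'm ^ 'm" and u p :: "'m::finite \<Rightarrow> 'a::euclidean_space"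
  assumes rows: "\<And>i. (\<Sum>j\<in>UNIV. W $ i $ j) = 1" and cols: "\<And>j. (\<Sum>i\<in>UNIV. W $ i $ j) = 1"
    and p: "\<And>i. norm (p i) \<le> c" and s: "s > 0"
  shows "dispersion (\<lambda>i. (\<Sum>j\<in>UNIV. W $ i $ j *\<^sub>R u j) - p i)
           \<le> (1 + s) * (spectral_norm (W - (\<chi> i j. 1 / real CARD('m))))\<^sup>2 * dispersion u
             + (1 + 1 / s) * (4 * real CARD('m) * c\<^sup>2)"
proof -
  define a where "a i = (\<Sum>j\<in>UNIV. W $ i $ j *\<^sub>R u j) - agent_mean u" for i
  define b where "b i = p i - agent_mean p" for i
  have "dispersion (\<lambda>i. (\<Sum>j\<in>UNIV. W $ i $ j *\<^sub>R u j) - p i) = (\<Sum>i\<in>UNIV. (norm (a i - b i))\<^sup>2)"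
    by (simp add: dispersion_def agent_mean_diff agent_mean_average[OF cols] a_def b_def algebra_simps)
  also have "\<dots> \<le> (\<Sum>i\<in>UNIV. (1 + s) * (norm (a i))\<^sup>2 + (1 + 1 / s) * (norm (b i))\<^sup>2)"
    by (intro sum_mono norm_diff_squared_le s)
  also have "\<dots> = (1 + s) * (\<Sum>i\<in>UNIV. (norm (a i))\<^sup>2) + (1 + 1 / s) * (\<Sum>i\<in>UNIV. (norm (b i))\<^sup>2)"
    by (simp add: sum.distrib sum_distrib_left)
  also have "\<dots> \<le> (1 + s) * ((spectral_norm (W - (\<chi> i j. 1 / real CARD('m))))\<^sup>2 * dispersion u)
      + (1 + 1 / s) * (4 * real CARD('m) * c\<^sup>2)"
  proof (intro add_mono mult_left_mono)
    show "(\<Sum>i\<in>UNIV. (norm (a i))\<^sup>2)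
        \<le> (spectral_norm (W - (\<chi> i j. 1 / real CARD('m))))\<^sup>2 * dispersion u"
      unfolding a_def by (rule mixing_contracts_dispersion[OF rows])
    have "norm (b i) \<le> 2 * c" for i
      using norm_triangle_ineq4[of "p i" "agent_mean p"] p[of i] norm_agent_mean_le[of p c, OF p]
      unfolding b_def by linarith
    then have "(norm (b i))\<^sup>2 \<le> 4 * c\<^sup>2" for i
      using power_mono[of "norm (b i)" "2 * c" 2] by (simp add: power_mult_distrib)
    from sum_mono[of UNIV "\<lambda>i. (norm (b i))\<^sup>2" "\<lambda>_. 4 * c\<^sup>2", OF this]
    show "(\<Sum>i\<in>UNIV. (norm (b i))\<^sup>2) \<le> 4 * real CARD('m) * c\<^sup>2" by simp
  qed (use s in auto)
  finally show ?thesis by (simp add: mult.assoc)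
qed

section \<open>Descent of the mean\<close>

lemma Young_inequality_weighted:
  fixes a b :: real
  assumes "\<epsilon> > 0"
  shows "2 * a * b \<le> \<epsilon> * a\<^sup>2 + b\<^sup>2 / \<epsilon>"
proof -
  have "0 \<le> (\<epsilon> * a - b)\<^sup>2 / \<epsilon>" using assms by simp
  also have "\<dots> = \<epsilon> * a\<^sup>2 + b\<^sup>2 / \<epsilon> - 2 * a * b"
    using assms by (simp add: field_simps power2_eq_square)
  finally show ?thesis by simp
qed

text \<open>The contribution of one agent, with stepsize \<open>l\<close> and position \<open>v\<close>, to the change of the squared
  distance from the mean \<open>z\<close> to \<open>\<theta>\<close>. Write \<open>l g(v) = (l - \<mu>) g(v) + \<mu> (g(v) - g(z)) + \<mu> g(z)\<close>: the
  first part is charged to the stepsize spread, the second to the disagreement of the agents through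
  the Lipschitz bound, and the third gives the decrease by convexity.\<close>

lemma local_descent:
  fixes f :: "'a::euclidean_space \<Rightarrow> real"
  assumes conv: "convex_on UNIV f" and grad: "\<And>v. GDERIV f v :> g v"
    and lip: "\<And>v v'. norm (g v - g v') \<le> L * norm (v - v')"
    and \<mu>: "0 \<le> \<mu>" and \<delta>: "\<bar>l - \<mu>\<bar> \<le> \<delta>" and \<epsilon>: "\<epsilon> > 0"
  shows "- 2 * (l * ((z - \<theta>) \<bullet> g v)) \<le> \<delta> * ((norm (g v))\<^sup>2 + (norm (z - \<theta>))\<^sup>2)
           + \<epsilon> * (norm (v - z))\<^sup>2 + (\<mu> * L * norm (z - \<theta>))\<^sup>2 / \<epsilon> - 2 * \<mu> * (f z - f \<theta>)"
proof -
  have "- 2 * ((l - \<mu>) * ((z - \<theta>) \<bullet> g v)) \<le> \<bar>l - \<mu>\<bar> * (2 * \<bar>(z - \<theta>) \<bullet> g v\<bar>)"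
    using abs_ge_minus_self[of "(l - \<mu>) * ((z - \<theta>) \<bullet> g v)"] unfolding abs_mult by linarith
  also have "\<dots> \<le> \<delta> * ((norm (g v))\<^sup>2 + (norm (z - \<theta>))\<^sup>2)"
  proof (rule mult_mono)
    have "2 * \<bar>(z - \<theta>) \<bullet> g v\<bar> \<le> 2 * norm (g v) * norm (z - \<theta>)"
      using Cauchy_Schwarz_ineq2[of "z - \<theta>" "g v"] by (simp add: mult.commute)
    also have "\<dots> \<le> (norm (g v))\<^sup>2 + (norm (z - \<theta>))\<^sup>2"
      by (rule sum_squares_bound)
    finally show "2 * \<bar>(z - \<theta>) \<bullet> g v\<bar> \<le> (norm (g v))\<^sup>2 + (norm (z - \<theta>))\<^sup>2" .
  qed (use \<delta> in auto)
  finally have uneven: "- 2 * ((l - \<mu>) * ((z - \<theta>) \<bullet> g v))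
      \<le> \<delta> * ((norm (g v))\<^sup>2 + (norm (z - \<theta>))\<^sup>2)" .
  have "- ((z - \<theta>) \<bullet> (g v - g z)) \<le> norm (z - \<theta>) * norm (g v - g z)"
    using Cauchy_Schwarz_ineq2[of "z - \<theta>" "g v - g z"] by linarith
  also have "\<dots> \<le> norm (z - \<theta>) * (L * norm (v - z))"
    by (intro mult_left_mono lip) auto
  finally have "\<mu> * - ((z - \<theta>) \<bullet> (g v - g z)) \<le> \<mu> * (norm (z - \<theta>) * (L * norm (v - z)))"
    using \<mu> by (rule mult_left_mono)
  also have "\<dots> = norm (v - z) * (\<mu> * L * norm (z - \<theta>))"
    by (simp only: mult_ac)
  finally have "- 2 * (\<mu> * ((z - \<theta>) \<bullet> (g v - g z))) \<le> 2 * norm (v - z) * (\<mu> * L * norm (z - \<theta>))"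
    unfolding mult_minus_right mult.assoc[of 2] by linarith
  also have "\<dots> \<le> \<epsilon> * (norm (v - z))\<^sup>2 + (\<mu> * L * norm (z - \<theta>))\<^sup>2 / \<epsilon>"
    by (rule Young_inequality_weighted[OF \<epsilon>])
  finally have disagreement: "- 2 * (\<mu> * ((z - \<theta>) \<bullet> (g v - g z)))
      \<le> \<epsilon> * (norm (v - z))\<^sup>2 + (\<mu> * L * norm (z - \<theta>))\<^sup>2 / \<epsilon>" .
  have "f z - f \<theta> \<le> (z - \<theta>) \<bullet> g z"
    using convex_gradient_inequality[OF conv grad, of z \<theta>]
    by (simp add: inner_diff_left inner_diff_right inner_commute)
  from mult_left_mono[OF this, of "2 * \<mu>"] \<mu>
  have descent: "- 2 * (\<mu> * ((z - \<theta>) \<bullet> g z)) \<le> - 2 * \<mu> * (f z - f \<theta>)"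
    by simp
  have "- 2 * (l * ((z - \<theta>) \<bullet> g v)) = - 2 * ((l - \<mu>) * ((z - \<theta>) \<bullet> g v))
      + - 2 * (\<mu> * ((z - \<theta>) \<bullet> (g v - g z))) + - 2 * (\<mu> * ((z - \<theta>) \<bullet> g z))"
    by (simp add: inner_diff_right algebra_simps)
  with uneven disagreement descent show ?thesis by linarith
qed

text \<open>Summing the local estimates over the agents and adding the second-order term of the step, which
  the Cauchy--Schwarz inequality splits into stepsizes and gradients.\<close>

lemma mean_descent:
  fixes f :: "'m::finite \<Rightarrow> 'a::euclidean_space \<Rightarrow> real" and u :: "'m \<Rightarrow> 'a"
  assumes conv: "\<And>j. convex_on UNIV (f j)" and grad: "\<And>j v. GDERIV (f j) v :> G j v"
    and lip: "\<And>j v v'. norm (G j v - G j v') \<le> L * norm (v - v')"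
    and l: "\<And>j. 0 \<le> l j" and \<mu>: "0 \<le> \<mu>" and \<delta>: "\<And>j. \<bar>l j - \<mu>\<bar> \<le> \<delta>" and \<epsilon>: "\<epsilon> > 0"
  defines "m \<equiv> real CARD('m)" and "z \<equiv> agent_mean u"
    and "Q \<equiv> \<Sum>j\<in>UNIV. (norm (G j (u j)))\<^sup>2"
  shows "(norm (z - (1 / m) *\<^sub>R (\<Sum>j\<in>UNIV. l j *\<^sub>R G j (u j)) - \<theta>))\<^sup>2
    \<le> (norm (z - \<theta>))\<^sup>2 + \<delta> * (Q / m + (norm (z - \<theta>))\<^sup>2) + \<epsilon> / m * dispersion u
      + (\<mu> * L * norm (z - \<theta>))\<^sup>2 / \<epsilon>
      - 2 * \<mu> * ((1 / m) * (\<Sum>j\<in>UNIV. f j z) - (1 / m) * (\<Sum>j\<in>UNIV. f j \<theta>))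
      + (1 / m\<^sup>2) * ((\<Sum>j\<in>UNIV. (l j)\<^sup>2) * Q)"
proof -
  define y where "y = (\<Sum>j\<in>UNIV. l j *\<^sub>R G j (u j))"
  have m: "m > 0" by (simp add: m_def)
  have "(norm (z - (1 / m) *\<^sub>R y - \<theta>))\<^sup>2 = (norm ((z - \<theta>) - (1 / m) *\<^sub>R y))\<^sup>2"
    by (simp add: algebra_simps)
  also have "\<dots> = (norm (z - \<theta>))\<^sup>2 + (1 / m) * (- 2 * ((z - \<theta>) \<bullet> y)) + (1 / m\<^sup>2) * (norm y)\<^sup>2"
    unfolding power2_norm_eq_inner
    by (simp add: inner_diff_left inner_diff_right inner_commute power2_eq_square algebra_simps)
  finally have expand: "(norm (z - (1 / m) *\<^sub>R y - \<theta>))\<^sup>2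
      = (norm (z - \<theta>))\<^sup>2 + (1 / m) * (- 2 * ((z - \<theta>) \<bullet> y)) + (1 / m\<^sup>2) * (norm y)\<^sup>2" .
  have "- 2 * ((z - \<theta>) \<bullet> y) = (\<Sum>j\<in>UNIV. - 2 * (l j * ((z - \<theta>) \<bullet> G j (u j))))"
    by (simp add: y_def inner_sum_right sum_distrib_left)
  also have "\<dots> \<le> (\<Sum>j\<in>UNIV. \<delta> * ((norm (G j (u j)))\<^sup>2 + (norm (z - \<theta>))\<^sup>2)
      + \<epsilon> * (norm (u j - z))\<^sup>2 + (\<mu> * L * norm (z - \<theta>))\<^sup>2 / \<epsilon> - 2 * \<mu> * (f j z - f j \<theta>))"
    by (intro sum_mono local_descent[OF conv grad lip \<mu> \<delta> \<epsilon>])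
  also have "\<dots> = \<delta> * (Q + m * (norm (z - \<theta>))\<^sup>2) + \<epsilon> * dispersion u
      + m * ((\<mu> * L * norm (z - \<theta>))\<^sup>2 / \<epsilon>) - 2 * \<mu> * ((\<Sum>j\<in>UNIV. f j z) - (\<Sum>j\<in>UNIV. f j \<theta>))"
    by (simp add: sum.distrib sum_subtractf sum_distrib_left[symmetric] Q_def m_def
        dispersion_def z_def)
  finally have "(1 / m) * (- 2 * ((z - \<theta>) \<bullet> y)) \<le> (1 / m) * \<dots>"
    using m by (intro mult_left_mono) auto
  also have "\<dots> = \<delta> * (Q / m + (norm (z - \<theta>))\<^sup>2) + \<epsilon> / m * dispersion u
      + (\<mu> * L * norm (z - \<theta>))\<^sup>2 / \<epsilon>
      - 2 * \<mu> * ((1 / m) * (\<Sum>j\<in>UNIV. f j z) - (1 / m) * (\<Sum>j\<in>UNIV. f j \<theta>))"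
    using m \<epsilon> by (simp add: field_simps)
  finally have cross: "(1 / m) * (- 2 * ((z - \<theta>) \<bullet> y)) \<le> \<dots>" .
  have "norm y \<le> (\<Sum>j\<in>UNIV. l j * norm (G j (u j)))"
    unfolding y_def by (rule order_trans[OF norm_sum]) (simp add: l)
  then have "(norm y)\<^sup>2 \<le> (\<Sum>j\<in>UNIV. l j * norm (G j (u j)))\<^sup>2"
    by (rule power_mono) simp
  also have "\<dots> \<le> (\<Sum>j\<in>UNIV. (l j)\<^sup>2) * Q"
    unfolding Q_def by (rule Cauchy_Schwarz_ineq_sum)
  finally have "(1 / m\<^sup>2) * (norm y)\<^sup>2 \<le> (1 / m\<^sup>2) * ((\<Sum>j\<in>UNIV. (l j)\<^sup>2) * Q)"
    by (intro mult_left_mono) auto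
  with expand cross show ?thesis unfolding y_def by linarith
qed

text \<open>Unbounded gradients are controlled by going from \<open>u j\<close> to the mean and from there to \<open>\<theta>\<close>. The constant sum at \<open>\<theta>\<close> does not vanish in general, even at a minimizer of the average,
  and is the reason for the \<open>+ 1\<close> in the energy estimate.\<close>

lemma gradient_growth:
  fixes G :: "'m::finite \<Rightarrow> 'a::euclidean_space \<Rightarrow> 'a"
  assumes lip: "\<And>j v v'. norm (G j v - G j v') \<le> L * norm (v - v')"
  shows "(\<Sum>j\<in>UNIV. (norm (G j (u j)))\<^sup>2)
    \<le> 3 * L\<^sup>2 * dispersion u + 3 * L\<^sup>2 * real CARD('m) * (norm (agent_mean u - \<theta>))\<^sup>2
      + 3 * (\<Sum>j\<in>UNIV. (norm (G j \<theta>))\<^sup>2)"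
proof -
  have sq3: "(a + b + c)\<^sup>2 \<le> 3 * a\<^sup>2 + 3 * b\<^sup>2 + 3 * c\<^sup>2" for a b c :: real
  proof -
    have "3 * a\<^sup>2 + 3 * b\<^sup>2 + 3 * c\<^sup>2 - (a + b + c)\<^sup>2 = (a - b)\<^sup>2 + (b - c)\<^sup>2 + (a - c)\<^sup>2"
      by (simp add: power2_eq_square algebra_simps)
    then show ?thesis
      by (smt (verit) zero_le_power2)
  qed
  have "(norm (G j (u j)))\<^sup>2 \<le> 3 * L\<^sup>2 * (norm (u j - agent_mean u))\<^sup>2
      + 3 * L\<^sup>2 * (norm (agent_mean u - \<theta>))\<^sup>2 + 3 * (norm (G j \<theta>))\<^sup>2" for j
  proof -
    have "norm (G j (u j)) \<le> norm (G j (u j) - G j (agent_mean u))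
        + norm (G j (agent_mean u) - G j \<theta>) + norm (G j \<theta>)"
      using norm_triangle_ineq[of "G j (u j) - G j (agent_mean u)" "G j (agent_mean u)"]
        norm_triangle_ineq[of "G j (agent_mean u) - G j \<theta>" "G j \<theta>"] by simp
    also have "\<dots> \<le> L * norm (u j - agent_mean u) + L * norm (agent_mean u - \<theta>) + norm (G j \<theta>)"
      by (intro add_mono lip order_refl)
    finally have "(norm (G j (u j)))\<^sup>2
        \<le> (L * norm (u j - agent_mean u) + L * norm (agent_mean u - \<theta>) + norm (G j \<theta>))\<^sup>2"
      by (rule power_mono) simp
    also note sq3
    finally show ?thesis by (simp add: power_mult_distrib)
  qed
  then have "(\<Sum>j\<in>UNIV. (norm (G j (u j)))\<^sup>2)
      \<le> (\<Sum>j\<in>UNIV. 3 * L\<^sup>2 * (norm (u j - agent_mean u))\<^sup>2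
        + 3 * L\<^sup>2 * (norm (agent_mean u - \<theta>))\<^sup>2 + 3 * (norm (G j \<theta>))\<^sup>2)"
    by (intro sum_mono)
  also have "\<dots> = 3 * L\<^sup>2 * dispersion u + 3 * L\<^sup>2 * real CARD('m) * (norm (agent_mean u - \<theta>))\<^sup>2
      + 3 * (\<Sum>j\<in>UNIV. (norm (G j \<theta>))\<^sup>2)"
    by (simp add: sum.distrib sum_distrib_left dispersion_def)
  finally show ?thesis .
qed

lemma mean_squared_le:
  fixes l :: "'m::finite \<Rightarrow> real"
  shows "(agent_mean l)\<^sup>2 \<le> (\<Sum>j\<in>UNIV. (l j)\<^sup>2)"
proof -
  let ?m = "real CARD('m)"
  have m: "1 \<le> ?m" using zero_less_card_finite[where 'a = 'm] by linarith
  have "(agent_mean l)\<^sup>2 = (\<Sum>j\<in>UNIV. l j)\<^sup>2 / ?m\<^sup>2"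
    by (simp add: agent_mean_def power_divide)
  also have "\<dots> \<le> ((\<Sum>j\<in>UNIV. (l j)\<^sup>2) * ?m) / ?m\<^sup>2"
    using sum_squared_le_sum_of_squares[of l UNIV] by (intro divide_right_mono) auto
  also have "\<dots> = (\<Sum>j\<in>UNIV. (l j)\<^sup>2) / ?m"
    using m by (simp add: power2_eq_square)
  also have "\<dots> \<le> (\<Sum>j\<in>UNIV. (l j)\<^sup>2) / 1"
    using m by (intro divide_left_mono) (auto simp: sum_nonneg)
  finally show ?thesis by simp
qed

text \<open>Averaging \<open>l i - l j\<close> over \<open>j\<close> gives \<open>l i - agent_mean l\<close>. This links the heterogeneity
  condition on pairs of agents to the common reference stepsize.\<close>

lemma deviation_from_mean_le_pairwise:
  fixes l :: "'m::finite \<Rightarrow> real"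
  shows "\<bar>l i - agent_mean l\<bar> \<le> (\<Sum>(i, j)\<in>{(i, j). i \<noteq> j}. \<bar>l i - l j\<bar>)"
proof -
  let ?m = "real CARD('m)"
  have m: "1 \<le> ?m" using zero_less_card_finite[where 'a = 'm] by linarith
  have "l i - agent_mean l = (\<Sum>j\<in>UNIV. l i - l j) / ?m"
    by (simp add: agent_mean_def sum_subtractf diff_divide_distrib)
  then have "\<bar>l i - agent_mean l\<bar> = \<bar>\<Sum>j\<in>UNIV. l i - l j\<bar> / ?m"
    by simp
  also have "\<dots> \<le> \<bar>\<Sum>j\<in>UNIV. l i - l j\<bar> / 1"
    using m by (intro divide_left_mono) auto
  also have "\<dots> \<le> (\<Sum>j\<in>UNIV. \<bar>l i - l j\<bar>)"
    using sum_abs[of "\<lambda>j. l i - l j" UNIV] by simp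
  also have "\<dots> = (\<Sum>j\<in>{j. i \<noteq> j}. \<bar>l i - l j\<bar>)"
    by (rule sum.mono_neutral_right) auto
  also have "\<dots> = (\<Sum>(i, j)\<in>Pair i ` {j. i \<noteq> j}. \<bar>l i - l j\<bar>)"
    by (subst sum.reindex) (auto simp: inj_on_def)
  also have "\<dots> \<le> (\<Sum>(i, j)\<in>{(i, j). i \<noteq> j}. \<bar>l i - l j\<bar>)"
    by (rule sum_mono2) auto
  finally show ?thesis .
qed

section \<open>Decrease of the energy\<close>

definition agent_step ::
  "real ^ 'm ^ 'm \<Rightarrow> real ^ 'm ^ 'm \<Rightarrow> ('m \<Rightarrow> real) \<Rightarrow> ('m \<Rightarrow> 'a \<Rightarrow> 'a) \<Rightarrow>
   ('m::finite \<Rightarrow> 'a) \<Rightarrow> 'm \<Rightarrow> 'a::real_vector" where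
  "agent_step W B l G u i =
     (\<Sum>j\<in>UNIV. W $ i $ j *\<^sub>R u j) - (\<Sum>j\<in>UNIV. B $ i $ j *\<^sub>R (l j *\<^sub>R G j (u j)))"

definition lyapunov :: "'a::real_normed_vector \<Rightarrow> ('m::finite \<Rightarrow> 'a) \<Rightarrow> real" where
  "lyapunov \<theta> u = (norm (agent_mean u - \<theta>))\<^sup>2 + dispersion u"

text \<open>The energy drops by the weighted optimality gap and a fixed multiple of the dispersion, up to a
  relative error of the order of the stepsize spread and the squared stepsizes.
  The point is the choice of the weight \<open>m * \<gamma>\<close> in Young's inequality: the first-order cost of
  disagreement is then \<open>\<gamma> * D\<close>, half of the amount \<open>(1 - q) * D\<close> that mixing gains.\<close>

lemma lyapunov_decrease:
  fixes f :: "'m::finite \<Rightarrow> 'a::euclidean_space \<Rightarrow> real" and W :: "real ^ 'm ^ 'm" and \<theta> :: 'a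
    and u :: "nat \<Rightarrow> 'm \<Rightarrow> 'a"
  assumes rows: "\<And>i. (\<Sum>j\<in>UNIV. W $ i $ j) = 1" and cols: "\<And>j. (\<Sum>i\<in>UNIV. W $ i $ j) = 1"
    and contraction: "spectral_norm (W - (\<chi> i j. 1 / real CARD('m))) < 1"
    and conv: "\<And>j. convex_on UNIV (f j)" and grad: "\<And>j v. GDERIV (f j) v :> G j v"
    and lip: "\<And>j v v'. norm (G j v - G j v') \<le> L * norm (v - v')"
    and stoch: "\<And>k. column_stochastic (B k)" and nonneg_l: "\<And>k j. 0 \<le> l k j"
    and spread: "\<And>k j. \<bar>l k j - agent_mean (l k)\<bar> \<le> \<delta> k"
    and run: "\<And>k. u (Suc k) = agent_step W (B k) (l k) G (u k)"
  shows "\<exists>C\<ge>0. \<exists>\<gamma>>0. \<forall>k. lyapunov \<theta> (u (Suc k))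
    \<le> lyapunov \<theta> (u k) + C * (\<delta> k + (\<Sum>j\<in>UNIV. (l k j)\<^sup>2)) * (lyapunov \<theta> (u k) + 1)
      - (2 * agent_mean (l k)
            * (agent_mean (\<lambda>j. f j (agent_mean (u k))) - agent_mean (\<lambda>j. f j \<theta>))
         + \<gamma> * dispersion (u k))"
proof -
  define m where "m = real CARD('m)"
  have m: "m \<ge> 1" unfolding m_def using zero_less_card_finite[where 'a = 'm] by linarith
  define \<eta> where "\<eta> = spectral_norm (W - (\<chi> i j. 1 / real CARD('m)))"
  have "0 \<le> \<eta>" unfolding \<eta>_def spectral_norm_def by (rule onorm_pos_le) simp
  then have \<eta>: "\<eta>\<^sup>2 < 1" using contraction by (simp add: \<eta>_def power_less_one_iff)
  \<comment> \<open>This \<open>s\<close> keeps the perturbed factor \<open>(1 + s) * \<eta>\<^sup>2\<close> below the midpoint \<open>q\<close> of \<open>\<eta>\<^sup>2\<close> and \<open>1\<close>.\<close>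
  define s where "s = (1 - \<eta>\<^sup>2) / 2"
  define q where "q = (1 + \<eta>\<^sup>2) / 2"
  define \<gamma> where "\<gamma> = (1 - q) / 2"
  have s: "s > 0" and \<gamma>: "\<gamma> > 0" using \<eta> by (auto simp: s_def \<gamma>_def q_def)
  have q: "(1 + s) * \<eta>\<^sup>2 \<le> q"
  proof -
    have "q - (1 + s) * \<eta>\<^sup>2 = (1 - \<eta>\<^sup>2) * (1 - \<eta>\<^sup>2) / 2"
      by (simp add: q_def s_def field_simps)
    also have "\<dots> \<ge> 0" by simp
    finally show ?thesis by simp
  qed
  define \<Gamma> where "\<Gamma> = (\<Sum>j\<in>UNIV. (norm (G j \<theta>))\<^sup>2)"
  have \<Gamma>: "\<Gamma> \<ge> 0" by (simp add: \<Gamma>_def sum_nonneg)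
  define K where "K = 3 * L\<^sup>2 * m + 3 * \<Gamma>"
  have K: "K \<ge> 0" using m \<Gamma> by (simp add: K_def)
  define c where "c = (1 + 1 / s) * (4 * m)"
  have c: "c \<ge> 0" using m s by (simp add: c_def)
  \<comment> \<open>\<open>K + 1\<close> pays for the stepsize spread and \<open>K\<close> alone for the squared step of the mean,
     the quotient for Young's inequality, and \<open>c * K\<close> for the perturbed dispersion.\<close>
  define C where "C = K + 1 + L\<^sup>2 / (m * \<gamma>) + c * K"
  have C: "C \<ge> 0" using K c m \<gamma> by (simp add: C_def)
  show ?thesis
  proof (rule exI[of _ C], intro conjI C, rule exI[of _ \<gamma>], intro conjI allI \<gamma>)
    fix k
    define V :: "('m \<Rightarrow> 'a) \<Rightarrow> real" where "V = lyapunov \<theta>"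
    define z where "z = agent_mean (u k)"
    define D where "D = dispersion (u k)"
    define r where "r = (norm (z - \<theta>))\<^sup>2"
    define S where "S = (\<Sum>j\<in>UNIV. (l k j)\<^sup>2)"
    define Q where "Q = (\<Sum>j\<in>UNIV. (norm (G j (u k j)))\<^sup>2)"
    define \<mu> where "\<mu> = agent_mean (l k)"
    define gap where "gap = agent_mean (\<lambda>j. f j z) - agent_mean (\<lambda>j. f j \<theta>)"
    define p where "p i = (\<Sum>j\<in>UNIV. B k $ i $ j *\<^sub>R (l k j *\<^sub>R G j (u k j)))" for i
    define u' where "u' i = (\<Sum>j\<in>UNIV. W $ i $ j *\<^sub>R u k j) - p i" for i
    have u'_eq: "u' = u (Suc k)"
      by (simp add: fun_eq_iff run u'_def p_def agent_step_def)
    have nonneg: "D \<ge> 0" "r \<ge> 0" "S \<ge> 0" "Q \<ge> 0" "\<delta> k \<ge> 0"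
      using order_trans[OF abs_ge_zero spread]
      by (auto simp: D_def dispersion_nonneg r_def S_def Q_def sum_nonneg)
    have \<mu>: "\<mu> \<ge> 0" by (simp add: \<mu>_def agent_mean_def sum_nonneg nonneg_l)
    have Vu: "V (u k) = r + D" by (simp add: V_def lyapunov_def r_def D_def z_def)
    have B_nonneg: "0 \<le> B k $ i $ j" and B_cols: "(\<Sum>i\<in>UNIV. B k $ i $ j) = 1" for i j
      using stoch[of k] by (auto simp: column_stochastic_def)
    have growth: "Q \<le> K * (V (u k) + 1)"
    proof -
      have "Q \<le> 3 * L\<^sup>2 * D + 3 * L\<^sup>2 * m * r + 3 * \<Gamma>"
        unfolding Q_def D_def m_def r_def z_def \<Gamma>_def by (rule gradient_growth[OF lip])
      also have "3 * L\<^sup>2 * D \<le> 3 * L\<^sup>2 * m * D"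
        using m nonneg by (simp add: mult_right_mono mult_le_cancel_left1)
      finally have "Q \<le> 3 * L\<^sup>2 * m * (r + D) + 3 * \<Gamma>" by (simp add: algebra_simps)
      moreover have "0 \<le> 3 * \<Gamma> * (r + D)" "0 \<le> 3 * L\<^sup>2 * m" using nonneg \<Gamma> m by auto
      ultimately show ?thesis by (simp add: K_def Vu algebra_simps)
    qed
    have "dispersion u' \<le> (1 + s) * \<eta>\<^sup>2 * D
        + (1 + 1 / s) * (4 * m * (\<Sum>j\<in>UNIV. l k j * norm (G j (u k j)))\<^sup>2)"
      unfolding u'_def D_def \<eta>_def m_def
    proof (rule dispersion_step[OF rows cols _ s])
      fix i
      have "B k $ i $ j \<le> 1" for j
        using member_le_sum[of i UNIV "\<lambda>i. B k $ i $ j"] B_nonneg B_cols[of j] by simp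
      then show "norm (p i) \<le> (\<Sum>j\<in>UNIV. l k j * norm (G j (u k j)))"
        unfolding p_def
        by (intro order_trans[OF norm_sum] sum_mono)
          (simp add: nonneg_l B_nonneg mult_left_le_one_le mult.assoc)
    qed
    also have "(1 + s) * \<eta>\<^sup>2 * D \<le> q * D"
      using q nonneg by (intro mult_right_mono) auto
    also have "(1 + 1 / s) * (4 * m * (\<Sum>j\<in>UNIV. l k j * norm (G j (u k j)))\<^sup>2) \<le> c * (S * Q)"
      unfolding c_def mult.assoc S_def Q_def using s m
      by (intro mult_left_mono Cauchy_Schwarz_ineq_sum) auto
    finally have disp: "dispersion u' \<le> q * D + c * (S * Q)" by simp
    \<comment> \<open>Mixing by \<open>W\<close> and \<open>B k\<close> is invisible to the mean.\<close>
    have "agent_mean u' = z - agent_mean p"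
      by (simp add: u'_def[abs_def] agent_mean_diff agent_mean_average[OF cols] z_def)
    also have "agent_mean p = (1 / m) *\<^sub>R (\<Sum>j\<in>UNIV. l k j *\<^sub>R G j (u k j))"
      unfolding p_def agent_mean_average[OF B_cols] by (simp add: agent_mean_def m_def)
    finally have "(norm (agent_mean u' - \<theta>))\<^sup>2 \<le> r + \<delta> k * (Q / m + r) + (m * \<gamma>) / m * D
        + (\<mu> * L * norm (z - \<theta>))\<^sup>2 / (m * \<gamma>) - 2 * \<mu> * gap + (1 / m\<^sup>2) * (S * Q)"
      using mean_descent[where f = f and G = G and L = L and l = "l k" and \<mu> = \<mu> and \<delta> = "\<delta> k"
          and \<epsilon> = "m * \<gamma>" and u = "u k" and \<theta> = \<theta>, OF conv grad lip nonneg_l \<mu>] spread m \<gamma>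
      by (simp add: z_def r_def S_def Q_def D_def gap_def agent_mean_def m_def \<mu>_def)
    moreover have "(\<mu> * L * norm (z - \<theta>))\<^sup>2 / (m * \<gamma>) \<le> S * (L\<^sup>2 / (m * \<gamma>)) * (V (u k) + 1)"
    proof -
      have "\<mu>\<^sup>2 * (L\<^sup>2 / (m * \<gamma>) * r) \<le> S * (L\<^sup>2 / (m * \<gamma>) * (V (u k) + 1))"
        unfolding \<mu>_def S_def
        by (intro mult_mono mean_squared_le) (use nonneg m \<gamma> in \<open>auto simp: Vu sum_nonneg\<close>)
      then show ?thesis by (simp add: r_def power_mult_distrib mult_ac)
    qed
    moreover have "\<delta> k * (Q / m + r) \<le> \<delta> k * ((K + 1) * (V (u k) + 1))"
    proof -
      have "Q / m \<le> Q" using m nonneg by (simp add: divide_le_eq mult_le_cancel_left1)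
      with growth show ?thesis
        using nonneg by (intro mult_left_mono) (auto simp: Vu algebra_simps)
    qed
    moreover have "(1 / m\<^sup>2) * (S * Q) \<le> S * (K * (V (u k) + 1))"
    proof -
      have "(1 / m\<^sup>2) * (S * Q) \<le> 1 * (S * Q)"
        using m nonneg by (intro mult_right_mono) auto
      also have "\<dots> \<le> S * (K * (V (u k) + 1))"
        using growth nonneg by (simp add: mult_left_mono)
      finally show ?thesis .
    qed
    moreover have "c * (S * Q) \<le> c * (S * (K * (V (u k) + 1)))"
      using growth nonneg c by (intro mult_left_mono) auto
    ultimately have "V u' \<le> r + q * D + \<gamma> * D - 2 * \<mu> * gap
        + (\<delta> k * ((K + 1) * (V (u k) + 1)) + S * (L\<^sup>2 / (m * \<gamma>)) * (V (u k) + 1)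
        + S * (K * (V (u k) + 1)) + c * (S * (K * (V (u k) + 1))))"
      using disp m by (simp add: V_def lyapunov_def)
    also have "\<dots> \<le> r + q * D + \<gamma> * D - 2 * \<mu> * gap + C * (\<delta> k + S) * (V (u k) + 1)"
    proof -
      \<comment> \<open>What remains of the generous constant \<open>C\<close> is nonnegative.\<close>
      have "C * (\<delta> k + S) * (V (u k) + 1)
        - (\<delta> k * ((K + 1) * (V (u k) + 1)) + S * (L\<^sup>2 / (m * \<gamma>)) * (V (u k) + 1)
        + S * (K * (V (u k) + 1)) + c * (S * (K * (V (u k) + 1))))
        = (\<delta> k * (L\<^sup>2 / (m * \<gamma>) + c * K) + S) * (V (u k) + 1)"
        unfolding C_def by (simp only: algebra_simps)
      also have "\<dots> \<ge> 0"
        using nonneg K c m \<gamma> by (simp add: Vu)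
      finally show ?thesis by simp
    qed
    also have "r + q * D + \<gamma> * D = V (u k) - \<gamma> * D"
      by (simp add: Vu \<gamma>_def field_simps)
    finally show "lyapunov \<theta> (u (Suc k))
      \<le> lyapunov \<theta> (u k) + C * (\<delta> k + (\<Sum>j\<in>UNIV. (l k j)\<^sup>2)) * (lyapunov \<theta> (u k) + 1)
        - (2 * agent_mean (l k)
              * (agent_mean (\<lambda>j. f j (agent_mean (u k))) - agent_mean (\<lambda>j. f j \<theta>))
           + \<gamma> * dispersion (u k))"
      unfolding \<mu>_def[symmetric] gap_def[unfolded z_def, symmetric] S_def[symmetric]
        D_def[symmetric] u'_eq[symmetric] V_def by linarith
  qed
qed

section \<open>From stacked vectors to agents\<close>

lemma block_mean_eq: "block_mean x = agent_mean (block x)"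
  by (simp add: block_mean_def agent_mean_def)

text \<open>The identity factor keeps the coordinates apart, so the Kronecker product mixes whole blocks.\<close>

lemma block_kronecker_mat1:
  fixes A :: "real ^ 'm ^ 'm" and x :: "real ^ ('m::finite \<times> 'd::finite)"
  shows "block ((A \<otimes>\<^sub>K (mat 1 :: real ^ 'd ^ 'd)) *v x) i = (\<Sum>j\<in>UNIV. A $ i $ j *\<^sub>R block x j)"
proof -
  have "(\<Sum>p\<in>UNIV. A $ i $ fst p * (mat 1 :: real ^ 'd ^ 'd) $ c $ snd p * x $ p)
      = (\<Sum>j\<in>UNIV. A $ i $ j * x $ (j, c))" for c
  proof -
    have "(\<Sum>p\<in>UNIV. A $ i $ fst p * (mat 1 :: real ^ 'd ^ 'd) $ c $ snd p * x $ p)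
      = (\<Sum>j\<in>UNIV. \<Sum>e\<in>UNIV. A $ i $ j * (mat 1 :: real ^ 'd ^ 'd) $ c $ e * x $ (j, e))"
      by (simp add: sum.cartesian_product case_prod_unfold flip: UNIV_Times_UNIV)
    also have "\<dots> = (\<Sum>j\<in>UNIV. \<Sum>e\<in>UNIV. if c = e then A $ i $ j * x $ (j, e) else 0)"
      by (intro sum.cong refl) (simp add: mat_def)
    finally show ?thesis by (simp add: sum.delta)
  qed
  then show ?thesis
    by (simp add: vec_eq_iff block_def kronecker_def matrix_vector_mult_def)
qed

lemma block_diff: "block (x - y) i = block x i - block y i"
  by (simp add: block_def vec_eq_iff)

lemma block_stack: "block (stack v) i = v i"
  by (simp add: block_def stack_def vec_eq_iff)

lemma mult_diag_matrix_nth: "(A ** diag_matrix v) $ i $ j = A $ i $ j * v $ j"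
  by (simp add: matrix_matrix_mult_def diag_matrix_def if_distrib[of "(*) _"] cong: if_cong)

lemma pdg_ds_agent_step:
  assumes "pdg_ds W B lam G x"
  shows "block (x (Suc k)) = agent_step W (B k) (($) (lam k)) G (block (x k))"
  using assms
  by (simp add: fun_eq_iff agent_step_def pdg_ds_def block_diff block_kronecker_mat1 block_stack
      mult_diag_matrix_nth)

section \<open>Convergence of the algorithm\<close>

theorem theorem1:
  fixes W :: "real ^ 'm ^ 'm"
    and B :: "nat \<Rightarrow> real ^ 'm ^ 'm"
    and lam :: "nat \<Rightarrow> real ^ 'm"
    and f :: "'m \<Rightarrow> real ^ 'd \<Rightarrow> real"
    and G :: "'m \<Rightarrow> real ^ 'd \<Rightarrow> real ^ 'd"
    and L :: real
    and x :: "nat \<Rightarrow> real ^ ('m::finite \<times> 'd::finite)"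
  assumes "interaction_weights W"
    and "1 v* W = 1" and "W *v 1 = 1"
    and "spectral_norm (W - (\<chi> i j. 1 / real CARD('m))) < 1"
    and "\<And>k. mixing_matrix W (B k)"
    and "\<exists>\<theta>. is_arg_min (average_objective f) (\<lambda>_. True) \<theta>"
    and "\<And>i. convex_on UNIV (f i)"
    and "\<And>i u. GDERIV (f i) u :> G i u"
    and "L > 0"
    and "\<And>i u v. norm (G i u - G i v) \<le> L * norm (u - v)"
    and "\<And>k i. 0 \<le> lam k $ i"
    and "\<And>i. filterlim (\<lambda>n. \<Sum>k<n. lam k $ i) at_top sequentially"
    and "\<And>i. summable (\<lambda>k. (lam k $ i)\<^sup>2)"
    and "summable (\<lambda>k. \<Sum>(i, j)\<in>{(i, j). i \<noteq> j}. \<bar>lam k $ i - lam k $ j\<bar>)"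
    and "pdg_ds W B lam G x"
  shows "(\<forall>i. (\<lambda>k. norm (block (x k) i - block_mean (x k))) \<longlonglongrightarrow> 0) \<and>
         (\<exists>\<theta>. is_arg_min (average_objective f) (\<lambda>_. True) \<theta> \<and>
              (\<lambda>k. norm (block_mean (x k) - \<theta>)) \<longlonglongrightarrow> 0)"
proof -
  have rows: "(\<Sum>j\<in>UNIV. W $ i $ j) = 1" for i
    using assms(3) by (simp add: vec_eq_iff matrix_vector_mult_def)
  have cols: "(\<Sum>i\<in>UNIV. W $ i $ j) = 1" for j
    using assms(2) by (simp add: vec_eq_iff vector_matrix_mult_def)
  have col_B: "column_stochastic (B k)" for k
    using assms(5) by (simp add: mixing_matrix_def)
  define z where "z k = agent_mean (block (x k))" for k
  define D where "D k = dispersion (block (x k))" for k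
  define \<mu> where "\<mu> k = agent_mean (\<lambda>j. lam k $ j)" for k
  define \<delta> where "\<delta> k = (\<Sum>(i, j)\<in>{(i, j). i \<noteq> j}. \<bar>lam k $ i - lam k $ j\<bar>)" for k
  define t where "t k = \<delta> k + (\<Sum>j\<in>UNIV. (lam k $ j)\<^sup>2)" for k
  have F: "average_objective f v = agent_mean (\<lambda>j. f j v)" for v
    by (simp add: average_objective_def agent_mean_def)
  have \<mu>: "0 \<le> \<mu> k" for k
    by (simp add: \<mu>_def agent_mean_def sum_nonneg assms(11))
  have t: "0 \<le> t k" for k
    by (auto simp: t_def \<delta>_def intro!: add_nonneg_nonneg sum_nonneg)
  have sum_t: "summable t"
    unfolding t_def \<delta>_def by (intro summable_add summable_sum assms(13,14))
  \<comment> \<open>This must hold for every minimizer, as the limit of the means is found only afterwards.\<close>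
  have asymptotics: "convergent (\<lambda>k. (norm (z k - \<theta>))\<^sup>2 + D k) \<and> summable D \<and>
      summable (\<lambda>k. \<mu> k * (average_objective f (z k) - average_objective f \<theta>))"
    if min: "is_arg_min (average_objective f) (\<lambda>_. True) \<theta>" for \<theta>
  proof -
    define V where "V k = lyapunov \<theta> (block (x k))" for k
    have V: "V k = (norm (z k - \<theta>))\<^sup>2 + D k" for k
      by (simp add: V_def lyapunov_def z_def D_def)
    define gap where "gap k = average_objective f (z k) - average_objective f \<theta>" for k
    obtain C \<gamma> where C: "C \<ge> 0" and \<gamma>: "\<gamma> > 0" and step:
      "\<And>k. V (Suc k) \<le> V k + (C * t k) * (V k + 1) - (2 * \<mu> k * gap k + \<gamma> * D k)"
      using lyapunov_decrease[where f = f and G = G and \<theta> = \<theta> and u = "\<lambda>k. block (x k)",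
          OF rows cols assms(4,7,8,10) col_B assms(11) deviation_from_mean_le_pairwise
          pdg_ds_agent_step[OF assms(15)]]
      unfolding V_def[symmetric] z_def[symmetric] D_def[symmetric] \<mu>_def[symmetric]
        \<delta>_def[symmetric] t_def[symmetric] F[symmetric] gap_def[symmetric]
      by blast
    have gap: "0 \<le> gap k" for k
      using min by (simp add: gap_def is_arg_min_linorder)
    have D: "0 \<le> D k" for k by (simp add: D_def dispersion_nonneg)
    have V0: "0 \<le> V k" and T0: "0 \<le> C * t k" and W0: "0 \<le> 2 * \<mu> k * gap k + \<gamma> * D k" for k
      using D[of k] C t[of k] \<mu>[of k] gap[of k] \<gamma> by (auto simp: V)
    note rs = deterministic_robbins_siegmund[of V "\<lambda>k. C * t k"
        "\<lambda>k. 2 * \<mu> k * gap k + \<gamma> * D k", OF V0 T0 W0 summable_mult[OF sum_t] step]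
    have "summable D"
    proof (rule summable_comparison_test'[OF summable_mult[OF rs(2)]])
      fix k
      have "D k = (1 / \<gamma>) * (\<gamma> * D k)" using \<gamma> by simp
      also have "\<dots> \<le> (1 / \<gamma>) * (2 * \<mu> k * gap k + \<gamma> * D k)"
        using \<gamma> \<mu>[of k] gap[of k] by (intro mult_left_mono) auto
      finally show "norm (D k) \<le> (1 / \<gamma>) * (2 * \<mu> k * gap k + \<gamma> * D k)"
        using D[of k] by simp
    qed
    moreover have "summable (\<lambda>k. \<mu> k * gap k)"
    proof (rule summable_comparison_test'[OF rs(2)])
      fix k
      have "0 \<le> \<mu> k * gap k" "0 \<le> \<gamma> * D k" using \<mu>[of k] gap[of k] \<gamma> D[of k] by auto
      then show "norm (\<mu> k * gap k) \<le> 2 * \<mu> k * gap k + \<gamma> * D k" by simp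
    qed
    ultimately show ?thesis using rs(1) by (simp add: ext[of V, OF V] gap_def)
  qed
  obtain \<theta>0 where \<theta>0: "is_arg_min (average_objective f) (\<lambda>_. True) \<theta>0" using assms(6) by blast
  have D_lim: "D \<longlonglongrightarrow> 0"
    using asymptotics[OF \<theta>0] summable_LIMSEQ_zero by blast
  have consensus: "(\<lambda>k. norm (block (x k) i - z k)) \<longlonglongrightarrow> 0" for i
  proof (rule tendsto_sandwich[where f = "\<lambda>_. 0" and h = "\<lambda>k. sqrt (D k)"])
    show "(\<lambda>k. sqrt (D k)) \<longlonglongrightarrow> 0"
      using tendsto_real_sqrt[OF D_lim] by simp
    show "\<forall>\<^sub>F k in sequentially. norm (block (x k) i - z k) \<le> sqrt (D k)"
      using deviation_le_dispersion[of "block (x _)" i]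
      unfolding z_def D_def by (intro always_eventually allI real_le_rsqrt)
  qed auto
  have "\<exists>\<theta>. is_arg_min (average_objective f) (\<lambda>_. True) \<theta> \<and> (\<lambda>k. norm (z k - \<theta>)) \<longlonglongrightarrow> 0"
  proof (rule converges_to_minimizer[where \<mu> = \<mu>, OF _ \<theta>0])
    show "continuous_on UNIV (average_objective f)"
    proof -
      have "continuous_on UNIV (f j)" for j
        by (intro continuous_at_imp_continuous_on ballI
            has_derivative_continuous[OF assms(8)[unfolded gderiv_def]])
      then show ?thesis
        unfolding average_objective_def[abs_def] by (intro continuous_intros)
    qed
    show "convergent (\<lambda>k. norm (z k - \<theta>))"
      if min: "is_arg_min (average_objective f) (\<lambda>_. True) \<theta>" for \<theta>
    proof -
      obtain v where "(\<lambda>k. (norm (z k - \<theta>))\<^sup>2 + D k) \<longlonglongrightarrow> v"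
        using asymptotics[OF min] by (auto simp: convergent_def)
      from tendsto_real_sqrt[OF tendsto_diff[OF this D_lim]] show ?thesis
        by (auto simp: convergent_def)
    qed
    show "\<not> summable \<mu>"
    proof
      assume sum: "summable \<mu>"
      fix i :: 'm
      have "summable (\<lambda>k. lam k $ i)"
      proof (rule summable_comparison_test'[OF summable_mult[OF sum]])
        fix k
        have "lam k $ i \<le> (\<Sum>j\<in>UNIV. lam k $ j)"
          by (rule member_le_sum) (auto simp: assms(11))
        also have "\<dots> = real CARD('m) * \<mu> k"
          by (simp add: \<mu>_def agent_mean_def)
        finally show "norm (lam k $ i) \<le> real CARD('m) * \<mu> k"
          by (simp add: assms(11))
      qed
      from summable_LIMSEQ[OF this] filterlim_at_top_imp_at_infinity[OF assms(12)] show False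
        by (rule not_tendsto_and_filterlim_at_infinity[OF sequentially_bot])
    qed
    show "summable (\<lambda>k. \<mu> k * (average_objective f (z k) - average_objective f \<theta>0))"
      using asymptotics[OF \<theta>0] by blast
  qed (rule \<mu>)
  with consensus show ?thesis by (simp add: block_mean_eq z_def)
qed

end
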